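(* Let $k,m$ be positive integers. Then, as an identity in the variables $x_1,\dots,x_k,y_1,\dots,y_k$, $$\sum_{\pi\in\mathrm{PF}(k,k,m)}x_1^{\#1(\pi)}\cdots x_k^{\#k(\pi)}\;y_1^{\#(\ell(\pi)k-k+1)(\pi)}\cdots y_k^{\#(\ell(\pi)k)(\pi)}$$ $$=(m-1)(x_1+\cdots+x_k)(y_1+\cdots+y_k)\big(x_1+\cdots+x_k+y_1+\cdots+y_k+(m-1)k\big)^{m-2}$$ $$\quad+(x_1y_1+\cdots+x_ky_k)(x_1y_1+\cdots+x_ky_k+k)(x_1y_1+\cdots+x_ky_k+mk)^{m-2}.$$
   Context: $\mathrm{PF}(k,k,m)$ is the set of $(k,k)$-parking functions of length $m$: sequences $\pi=(\pi_1,\dots,\pi_m)$ of positive integers whose weakly increasing rearrangement $\lambda_1\le\cdots\le\lambda_m$ satisfies $\lambda_i\le ik$ for $1\le i\le m$. Here $\#i(\pi)=\#\{j:\pi_j=i\}$, and $\ell(\pi)=\lceil \pi_1/k\rceil$ is the index of the leading block, i.e. $\pi_1\in\{\ell(\pi)k-k+1,\dots,\ell(\pi)k\}$; so the exponent of $y_r$ is $\#\{j:\pi_j=\ell(\pi)k-k+r\}$. For $m=1$ (exponent $-1$) the right-hand side is read as a rational function. *)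

theory Defs
  imports
    "HOL-Library.Poly_Mapping"
    "HOL-Computational_Algebra.Polynomial_Factorial"
begin

(* A sequence (p_1, ..., p_m) is a list of length m, so p_j is  p ! (j - 1). *)
definition PF :: "nat \<Rightarrow> nat \<Rightarrow> nat list set" where
  "PF k m = {p. length p = m \<and> (\<forall>a\<in>set p. a > 0) \<and> (\<forall>i\<in>{1..m}. sort p ! (i - 1) \<le> i * k)}"

(* Otherwise a sum over  PF k m  would be 0 by the convention for infinite sets. *)
lemma finite_PF: "finite (PF k m)"
proof (rule finite_subset)
  show "PF k m \<subseteq> {p. set p \<subseteq> {..m * k} \<and> length p = m}"
  proof (safe)
    fix p a assume p: "p \<in> PF k m" and "a \<in> set p"
    then have "a \<in> set (sort p)" by simp
    then obtain j where j: "j < length (sort p)" "sort p ! j = a"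
      by (meson in_set_conv_nth)
    from p have len: "length p = m"
      and srt: "\<And>i. i \<in> {1..m} \<Longrightarrow> sort p ! (i - 1) \<le> i * k"
      by (simp_all add: PF_def)
    have "Suc j \<le> m" using j(1) len by simp
    moreover have "a \<le> Suc j * k"
      using srt[of "Suc j"] \<open>Suc j \<le> m\<close> j(2) by (simp del: mult_Suc)
    ultimately have "a \<le> Suc j * k" "Suc j * k \<le> m * k"
      by (simp_all del: mult_Suc)
    then show "a \<le> m * k" by (rule order.trans)
  qed (simp add: PF_def)
  show "finite {p. set p \<subseteq> {..m * k} \<and> length p = m}"
    by (rule finite_lists_length_eq) simp
qed

definition leading_block :: "nat \<Rightarrow> nat list \<Rightarrow> nat" where
  "leading_block k p = nat \<lceil>real (p ! 0) / real k\<rceil>"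

(* The block of k consecutive integers that contains p_1; in particular the
   truncated subtraction  l * k - k  on natural numbers is harmless, as l > 0. *)
lemma leading_block_bounds:
  assumes "k > 0" "m > 0" "p \<in> PF k m"
  defines "l \<equiv> leading_block k p"
  shows "l > 0" "p ! 0 \<in> {l * k - k + 1..l * k}"
proof -
  let ?q = "real (p ! 0) / real k"
  have pos: "p ! 0 > 0" using assms(2,3) by (auto simp: PF_def)
  then have "?q > 0" using assms(1) by simp
  then have l: "real l = of_int \<lceil>?q\<rceil>"
    unfolding l_def leading_block_def by simp
  then have up: "?q \<le> real l" and lo: "real l - 1 < ?q" by linarith+
  show lpos: "l > 0" using up \<open>?q > 0\<close> by (cases "l = 0") auto
  have "real (p ! 0) \<le> real (l * k)"
    using up assms(1) by (simp add: field_simps)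
  then have 1: "p ! 0 \<le> l * k" by linarith
  have "real (l * k) < real (p ! 0 + k)"
    using lo assms(1) by (simp add: field_simps)
  then have 2: "l * k < p ! 0 + k" by linarith
  have "k \<le> l * k" using lpos by simp
  with 1 2 show "p ! 0 \<in> {l * k - k + 1..l * k}"
    unfolding atLeastAtMost_iff by linarith
qed

(* The field of rational functions over the integral domain of integer
   polynomials in variables indexed by nat: a monomial is a finitely supported
   exponent vector, a polynomial a finitely supported map from monomials to
   coefficients. *)
type_synonym int_mpoly = "(nat \<Rightarrow>\<^sub>0 nat) \<Rightarrow>\<^sub>0 int"
type_synonym ratfun = "int_mpoly fract"

definition mpoly_var :: "nat \<Rightarrow> int_mpoly" where
  "mpoly_var n = Poly_Mapping.single (Poly_Mapping.single n 1) 1"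

(* Even and odd indices keep the two families of indeterminates disjoint. *)
definition X :: "nat \<Rightarrow> ratfun" where
  "X i = to_fract (mpoly_var (2 * i))"

definition Y :: "nat \<Rightarrow> ratfun" where
  "Y i = to_fract (mpoly_var (2 * i + 1))"

end

theory Submission
  imports Defs
begin

text \<open>
  Only the blocks of length \<open>k\<close> matter for the parking condition: a sequence is a parking function iff
  its sequence of block indices is an ordinary parking function, that is, iff for every \<open>i\<close> at most
  \<open>m - i\<close> entries lie beyond the \<open>i\<close>-th block. Number the blocks backwards, so that the first block
  gets rank \<open>m\<close> and the last one rank \<open>1\<close>. The condition then says that for every \<open>i\<close> at most \<open>i\<close>
  entries have rank at most \<open>i\<close>, and in this form it is stable under erasing the entries of the
  highest rank: what remains satisfies the same condition with one rank fewer. The \<open>x\<close>-weight lives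
  on the highest rank, so every sum needed here obeys a recursion in the number \<open>N\<close> of ranks:
  insert \<open>s\<close> letters of top rank, in \<open>n choose s\<close> ways, into a shorter word
  (\<open>sum_lists_insert_letters\<close>).

  With every letter weighted 1, the number \<open>G N n\<close> of words of length \<open>n \<le> N + 1\<close> satisfies
  \<open>(N + 1) G N n = (N + 1 - n) ((N + 1) k)\<^sup>n\<close> (\<open>card_parking_words\<close>). If instead the letters that
  share the rank of the first letter carry weights whose sum over each rank is \<open>V\<close>, the words of
  length \<open>n + 1 \<le> N + 1\<close> have total weight \<open>V (N - n) (V + N k)\<^sup>n\<close> (\<open>sum_weight_of_hd_level\<close>). Because these
  closed forms are affine in \<open>n\<close> times an \<open>n\<close>-th power, the recursions only involve the binomial
  theorem and its derivative (\<open>sum_binomial_affine\<close>).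

  One more insertion of the top rank gives the two summands of the theorem. If the first entry lies
  outside the first block, the first block is weighted by \<open>x\<close> and the block of the first entry by
  \<open>y\<close>, which yields the summand with the factor \<open>m - 1\<close>. If the first entry lies in the first block,
  each entry there has weight \<open>x\<^sub>i y\<^sub>i\<close> and all the others are merely counted, which yields the summand
  in \<open>x\<^sub>1 y\<^sub>1 + \<dots> + x\<^sub>k y\<^sub>k\<close>.
\<close>

section \<open>Binomial sums\<close>

text \<open>The recursions below yield positive integer multiples of the weights, so positive integers have
  to be cancellable among rational functions.\<close>

instance fract :: ("{idom, ring_char_0}") ring_char_0
proof
  show "inj (of_nat :: nat \<Rightarrow> 'a fract)"
    by (rule injI) (simp add: of_nat_fract eq_fract)
qed

text \<open>This is \<open>x\<close> times the derivative with respect to \<open>x\<close> of the binomial theorem.\<close>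

lemma sum_binomial_weight:
  fixes x z :: "'a::comm_ring_1"
  shows "(\<Sum>s\<le>n. of_nat (n choose s) * x ^ s * (of_nat s * z ^ (n - s))) =
    of_nat n * x * (x + z) ^ (n - 1)"
proof (cases n)
  case (Suc j)
  have "(\<Sum>s\<le>n. of_nat (n choose s) * x ^ s * (of_nat s * z ^ (n - s))) =
      (\<Sum>s\<le>j. of_nat (Suc s * (Suc j choose Suc s)) * x ^ Suc s * z ^ (j - s))"
    unfolding Suc by (subst sum.atMost_Suc_shift) (simp add: algebra_simps del: binomial_Suc_Suc)
  also have "\<dots> = (\<Sum>s\<le>j. of_nat n * x * (of_nat (j choose s) * x ^ s * z ^ (j - s)))"
    unfolding Suc_times_binomial Suc by (simp add: algebra_simps)
  finally show ?thesis
    by (simp add: Suc binomial_ring sum_distrib_left)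
qed simp

lemma sum_binomial_affine:
  fixes x z b :: "'a::comm_ring_1"
  shows "(\<Sum>s\<le>n. of_nat (n choose s) * x ^ s * ((b + of_nat s) * z ^ (n - s))) =
    b * (x + z) ^ n + of_nat n * x * (x + z) ^ (n - 1)"
proof -
  have "(\<Sum>s\<le>n. of_nat (n choose s) * x ^ s * ((b + of_nat s) * z ^ (n - s))) =
      b * (\<Sum>s\<le>n. of_nat (n choose s) * x ^ s * z ^ (n - s)) +
      (\<Sum>s\<le>n. of_nat (n choose s) * x ^ s * (of_nat s * z ^ (n - s)))"
    by (simp add: sum_distrib_left sum.distrib[symmetric] algebra_simps)
  then show ?thesis
    by (simp add: sum_binomial_weight binomial_ring)
qed

section \<open>Inserting letters into words\<close>

lemma sum_lists_Suc:
  fixes f :: "'b list \<Rightarrow> 'a::comm_monoid_add"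
  shows "(\<Sum>p | set p \<subseteq> A \<and> length p = Suc n. f p) =
    (\<Sum>a\<in>A. \<Sum>q | set q \<subseteq> A \<and> length q = n. f (a # q))"
proof -
  have "(\<Sum>p | set p \<subseteq> A \<and> length p = Suc n. f p) =
      (\<Sum>(q, a)\<in>{q. set q \<subseteq> A \<and> length q = n} \<times> A. f (a # q))"
    unfolding lists_length_Suc_eq
    by (subst sum.reindex) (auto simp: inj_on_def intro!: sum.cong)
  then show ?thesis
    by (simp add: sum.cartesian_product[symmetric] sum.swap[of _ A])
qed

text \<open>A word over a disjoint union is a word over \<open>B\<close> together with a word over \<open>A\<close> and a choice of the
  positions of the latter. The induction follows Pascal's rule by splitting off the first letter;
  \<open>F\<close> varies in it, since a first letter from \<open>B\<close> is absorbed into \<open>F\<close>.\<close>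

lemma sum_lists_insert_letters:
  fixes w :: "'b \<Rightarrow> 'a::comm_ring_1"
  assumes fin: "finite A" "finite B" and disj: "A \<inter> B = {}"
  shows "(\<Sum>p | set p \<subseteq> A \<union> B \<and> length p = n.
      prod_list (map w (filter (\<lambda>x. x \<in> A) p)) * F (filter (\<lambda>x. x \<notin> A) p)) =
    (\<Sum>s\<le>n. of_nat (n choose s) * sum w A ^ s * (\<Sum>q | set q \<subseteq> B \<and> length q = n - s. F q))"
proof (induction n arbitrary: F)
  case 0
  have "{p. set p \<subseteq> A \<union> B \<and> length p = 0} = {[]}" "{q. set q \<subseteq> B \<and> length q = 0} = {[]}"
    by auto
  then show ?case by simp
next
  case (Suc n)
  let ?L = "\<lambda>n F. \<Sum>p | set p \<subseteq> A \<union> B \<and> length p = n.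
      prod_list (map w (filter (\<lambda>x. x \<in> A) p)) * F (filter (\<lambda>x. x \<notin> A) p)"
  let ?T = "\<lambda>n F. \<Sum>q | set q \<subseteq> B \<and> length q = n. F q"
  let ?W = "sum w A"
  let ?R = "\<lambda>n F. \<Sum>s\<le>n. of_nat (n choose s) * ?W ^ s * ?T (n - s) F"
  have L: "?L (Suc n) F = ?W * ?L n F + (\<Sum>b\<in>B. ?L n (\<lambda>q. F (b # q)))"
    unfolding sum_lists_Suc sum.union_disjoint[OF fin disj] sum_distrib_right
    by (intro arg_cong2[of _ _ _ _ "(+)"] sum.cong refl)
      (use disj in \<open>auto simp: sum_distrib_left mult.assoc intro!: sum.cong\<close>)
  have T: "(\<Sum>b\<in>B. ?T j (\<lambda>q. F (b # q))) = ?T (Suc j) F" for j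
    by (simp add: sum_lists_Suc)
  have Pascal: "(\<Sum>s\<le>Suc n. of_nat (Suc n choose s) * ?W ^ s * ?T (Suc n - s) F) =
      (\<Sum>s\<le>n. of_nat (n choose s) * ?W ^ Suc s * ?T (n - s) F) +
      (\<Sum>s\<le>n. of_nat (n choose s) * ?W ^ s * ?T (Suc n - s) F)"
  proof -
    have "(\<Sum>s\<le>n. of_nat (n choose s) * ?W ^ s * ?T (Suc n - s) F) =
        (\<Sum>s\<le>Suc n. of_nat (n choose s) * ?W ^ s * ?T (Suc n - s) F)"
      by (simp add: binomial_eq_0)
    also have "\<dots> = ?T (Suc n) F + (\<Sum>s\<le>n. of_nat (n choose Suc s) * ?W ^ Suc s * ?T (n - s) F)"
      by (subst sum.atMost_Suc_shift) simp
    finally show ?thesis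
      by (subst sum.atMost_Suc_shift) (simp add: distrib_right sum.distrib)
  qed
  have "?L (Suc n) F = ?W * ?R n F + (\<Sum>b\<in>B. ?R n (\<lambda>q. F (b # q)))"
    unfolding L Suc[of F] by (intro arg_cong2[of _ _ _ _ "(+)"] sum.cong refl Suc)
  also have "(\<Sum>b\<in>B. ?R n (\<lambda>q. F (b # q))) =
      (\<Sum>s\<le>n. of_nat (n choose s) * ?W ^ s * ?T (Suc n - s) F)"
    by (subst sum.swap) (auto simp: sum_distrib_left[symmetric] T Suc_diff_le intro!: sum.cong)
  also have "?W * ?R n F = (\<Sum>s\<le>n. of_nat (n choose s) * ?W ^ Suc s * ?T (n - s) F)"
    by (simp add: sum_distrib_left mult_ac)
  finally show ?case
    unfolding Pascal .
qed

section \<open>Parking words over a ranked alphabet\<close>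

lemma prod_list_map_mult:
  fixes f g :: "'b \<Rightarrow> 'a::comm_monoid_mult"
  shows "prod_list (map (\<lambda>x. f x * g x) xs) = prod_list (map f xs) * prod_list (map g xs)"
  by (induction xs) (simp_all add: mult_ac)

text \<open>The argument uses nothing about the letters except how many of them share a rank. Rank
  \<open>0\<close> and the ranks above \<open>m\<close> hold the letters that do not occur in words.\<close>

locale ranked_alphabet =
  fixes rk :: "'b \<Rightarrow> nat" and k m :: nat
  assumes k_pos: "k > 0"
    and card_level: "\<And>i. 0 < i \<Longrightarrow> i \<le> m \<Longrightarrow> card {x. rk x = i} = k"
begin

definition alphabet :: "nat \<Rightarrow> 'b set" where
  "alphabet N = {x. 0 < rk x \<and> rk x \<le> N}"

text \<open>The parking condition read from the last block: rank \<open>i\<close> stands for the \<open>i\<close>-th block from the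
  end.\<close>

definition parks :: "nat \<Rightarrow> 'b list \<Rightarrow> bool" where
  "parks N p \<longleftrightarrow> (\<forall>i\<le>N. length (filter (\<lambda>x. rk x \<le> i) p) \<le> i)"

definition parking_words :: "nat \<Rightarrow> nat \<Rightarrow> 'b list set" where
  "parking_words N n = {p. set p \<subseteq> alphabet N \<and> length p = n \<and> parks N p}"

lemma finite_level: "0 < i \<Longrightarrow> i \<le> m \<Longrightarrow> finite {x. rk x = i}"
  using card_level k_pos by (metis card.infinite less_numeral_extra(3))

lemma alphabet_Suc: "alphabet (Suc N) = {x. rk x = Suc N} \<union> alphabet N"
  by (auto simp: alphabet_def)

lemma finite_alphabet: "N \<le> m \<Longrightarrow> finite (alphabet N)"
proof (induction N)
  case 0
  have "alphabet 0 = {}"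
    by (auto simp: alphabet_def)
  then show ?case by simp
next
  case (Suc N)
  then show ?case by (simp add: alphabet_Suc finite_level)
qed

lemma finite_parking_words: "N \<le> m \<Longrightarrow> finite (parking_words N n)"
  by (rule finite_subset[OF _ finite_lists_length_eq[OF finite_alphabet, of N n]])
    (auto simp: parking_words_def)

lemma sum_parking_words_split_hd:
  assumes "N \<le> m"
  shows "(\<Sum>p\<in>parking_words N n. F p) =
    (\<Sum>p | p \<in> parking_words N n \<and> rk (hd p) = t. F p) +
    (\<Sum>p | p \<in> parking_words N n \<and> rk (hd p) \<noteq> t. F p)"
  by (subst sum.union_disjoint[symmetric])
    (auto simp: finite_parking_words assms intro!: sum.cong)

text \<open>For a first letter below the top rank, the weight of its rank can be read off after the letters
  of top rank have been erased.\<close>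

lemma filter_hd_level_drop_level:
  assumes "p \<noteq> []" "rk (hd p) \<noteq> t"
  shows "filter (\<lambda>x. rk x = rk (hd (filter (\<lambda>x. rk x \<noteq> t) p))) (filter (\<lambda>x. rk x \<noteq> t) p) =
    filter (\<lambda>x. rk x = rk (hd p)) p"
proof -
  have "hd (filter (\<lambda>x. rk x \<noteq> t) p) = hd p"
    using assms by (cases p) auto
  then show ?thesis
    using assms(2) by (auto intro!: filter_cong)
qed

text \<open>The condition at \<open>i = N\<close> bounds the length of the word.\<close>

lemma parking_words_empty: "N < n \<Longrightarrow> parking_words N n = {}"
proof -
  have "length p \<le> N" if "set p \<subseteq> alphabet N" "parks N p" for p
  proof -
    have "filter (\<lambda>x. rk x \<le> N) p = p"
      using that(1) by (auto simp: alphabet_def filter_id_conv)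
    then show ?thesis
      using that(2) by (auto simp: parks_def)
  qed
  then show "N < n \<Longrightarrow> parking_words N n = {}"
    by (fastforce simp: parking_words_def)
qed

text \<open>The conditions for ranks up to \<open>N\<close> do not see the letters of rank \<open>N + 1\<close>, and the condition at
  \<open>N + 1\<close> itself only bounds the length.\<close>

lemma parks_Suc:
  assumes "set p \<subseteq> alphabet (Suc N)" "length p \<le> Suc N"
  shows "parks (Suc N) p \<longleftrightarrow> parks N (filter (\<lambda>x. rk x \<noteq> Suc N) p)"
proof -
  have "filter (\<lambda>x. rk x \<le> i) (filter (\<lambda>x. rk x \<noteq> Suc N) p) = filter (\<lambda>x. rk x \<le> i) p"
    if "i \<le> N" for i
    using that by (auto intro: filter_cong)
  moreover have "length (filter (\<lambda>x. rk x \<le> Suc N) p) \<le> Suc N"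
    using assms(2) length_filter_le le_trans by blast
  ultimately show ?thesis
    unfolding parks_def by (auto simp del: filter_filter simp: le_Suc_eq)
qed

text \<open>The parking condition is moved into the summand, so that the insertion lemma, which concerns
  all words, applies.\<close>

lemma sum_parking_words_as_lists:
  assumes "N \<le> m"
  shows "(\<Sum>p\<in>parking_words N n. F p) =
    (\<Sum>p | set p \<subseteq> alphabet N \<and> length p = n. if parks N p then F p else 0)"
proof -
  have "parking_words N n = {p \<in> {p. set p \<subseteq> alphabet N \<and> length p = n}. parks N p}"
    by (auto simp: parking_words_def)
  then show ?thesis
    by (simp only: sum.inter_filter finite_lists_length_eq finite_alphabet assms)
qed

lemma sum_insert_top:
  fixes w :: "'b \<Rightarrow> 'a::comm_ring_1"
  assumes N: "Suc N \<le> m"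
  shows "(\<Sum>p | set p \<subseteq> alphabet (Suc N) \<and> length p = n.
      prod_list (map w (filter (\<lambda>x. rk x = Suc N) p)) * F (filter (\<lambda>x. rk x \<noteq> Suc N) p)) =
    (\<Sum>s\<le>n. of_nat (n choose s) * (\<Sum>a | rk a = Suc N. w a) ^ s *
      (\<Sum>q | set q \<subseteq> alphabet N \<and> length q = n - s. F q))"
proof -
  have "{x. rk x = Suc N} \<inter> alphabet N = {}"
    by (auto simp: alphabet_def)
  from sum_lists_insert_letters[OF finite_level finite_alphabet this, of w F n]
  show ?thesis using N by (simp add: alphabet_Suc)
qed

text \<open>The recursion in the number of ranks, for summands that are multiplicative on the top rank. The
  lemmas \<open>sum_parking_words_hd_top\<close> and \<open>sum_parking_words_hd_below\<close> refine it according to the first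
  letter: a first letter of top rank contributes a factor of its own, any other one survives as the
  first letter of the remaining word.\<close>

lemma sum_parking_words_Suc:
  fixes w :: "'b \<Rightarrow> 'a::comm_ring_1"
  assumes N: "Suc N \<le> m" and n: "n \<le> Suc N"
  shows "(\<Sum>p\<in>parking_words (Suc N) n.
      prod_list (map w (filter (\<lambda>x. rk x = Suc N) p)) * F (filter (\<lambda>x. rk x \<noteq> Suc N) p)) =
    (\<Sum>s\<le>n. of_nat (n choose s) * (\<Sum>a | rk a = Suc N. w a) ^ s *
      (\<Sum>q\<in>parking_words N (n - s). F q))"
proof -
  have "(\<Sum>p\<in>parking_words (Suc N) n.
      prod_list (map w (filter (\<lambda>x. rk x = Suc N) p)) * F (filter (\<lambda>x. rk x \<noteq> Suc N) p)) =
    (\<Sum>p | set p \<subseteq> alphabet (Suc N) \<and> length p = n.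
      prod_list (map w (filter (\<lambda>x. rk x = Suc N) p)) *
      (\<lambda>q. if parks N q then F q else 0) (filter (\<lambda>x. rk x \<noteq> Suc N) p))"
    unfolding sum_parking_words_as_lists[OF N]
    using n by (intro sum.cong refl) (simp add: parks_Suc)
  also note sum_insert_top[OF N]
  finally show ?thesis
    using N by (simp add: sum_parking_words_as_lists)
qed

lemma sum_parking_words_hd_as_lists:
  assumes "Suc N \<le> m" "n \<le> N"
  shows "(\<Sum>p | p \<in> parking_words (Suc N) (Suc n) \<and> P (rk (hd p)). F p) =
    (\<Sum>a | a \<in> alphabet (Suc N) \<and> P (rk a).
      \<Sum>q | set q \<subseteq> alphabet (Suc N) \<and> length q = n.
        if parks N (filter (\<lambda>x. rk x \<noteq> Suc N) (a # q)) then F (a # q) else 0)"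
proof -
  note fin = finite_parking_words[OF assms(1), of "Suc n"]
  have "(\<Sum>p | p \<in> parking_words (Suc N) (Suc n) \<and> P (rk (hd p)). F p) =
      (\<Sum>a\<in>alphabet (Suc N). \<Sum>q | set q \<subseteq> alphabet (Suc N) \<and> length q = n.
        if parks (Suc N) (a # q) then if P (rk a) then F (a # q) else 0 else 0)"
    by (simp add: sum.inter_filter[OF fin] sum_parking_words_as_lists[OF assms(1)] sum_lists_Suc cong: if_cong)
  also have "\<dots> = (\<Sum>a\<in>alphabet (Suc N). if P (rk a) then
      \<Sum>q | set q \<subseteq> alphabet (Suc N) \<and> length q = n.
        if parks N (filter (\<lambda>x. rk x \<noteq> Suc N) (a # q)) then F (a # q) else 0 else 0)"
    using assms(2) by (intro sum.cong refl) (auto simp: parks_Suc intro!: sum.cong sum.neutral)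
  finally show ?thesis
    by (simp add: sum.inter_filter[OF finite_alphabet[OF assms(1)]] del: filter.simps)
qed

lemma sum_parking_words_hd_top:
  fixes w :: "'b \<Rightarrow> 'a::comm_ring_1"
  assumes N: "Suc N \<le> m" and n: "n \<le> N"
  shows "(\<Sum>p | p \<in> parking_words (Suc N) (Suc n) \<and> rk (hd p) = Suc N.
      prod_list (map w (filter (\<lambda>x. rk x = Suc N) p)) * F (filter (\<lambda>x. rk x \<noteq> Suc N) p)) =
    (\<Sum>a | rk a = Suc N. w a) * (\<Sum>s\<le>n. of_nat (n choose s) * (\<Sum>a | rk a = Suc N. w a) ^ s *
      (\<Sum>q\<in>parking_words N (n - s). F q))"
proof -
  have A: "{a. a \<in> alphabet (Suc N) \<and> rk a = Suc N} = {a. rk a = Suc N}"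
    by (auto simp: alphabet_def)
  let ?G = "\<lambda>q. if parks N q then F q else 0"
  have "(\<Sum>p | p \<in> parking_words (Suc N) (Suc n) \<and> rk (hd p) = Suc N.
      prod_list (map w (filter (\<lambda>x. rk x = Suc N) p)) * F (filter (\<lambda>x. rk x \<noteq> Suc N) p)) =
    (\<Sum>a | rk a = Suc N. w a) * (\<Sum>p | set p \<subseteq> alphabet (Suc N) \<and> length p = n.
      prod_list (map w (filter (\<lambda>x. rk x = Suc N) p)) * ?G (filter (\<lambda>x. rk x \<noteq> Suc N) p))"
    unfolding sum_parking_words_hd_as_lists[OF N n, where P = "\<lambda>r. r = Suc N"] A sum_distrib_right
    by (intro sum.cong refl) (auto simp: sum_distrib_left mult.assoc intro!: sum.cong)
  also note sum_insert_top[OF N, of w ?G n]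
  finally show ?thesis
    using N by (simp add: sum_parking_words_as_lists)
qed

lemma sum_parking_words_hd_below:
  fixes w :: "'b \<Rightarrow> 'a::comm_ring_1"
  assumes N: "Suc N \<le> m" and n: "n \<le> N"
  shows "(\<Sum>p | p \<in> parking_words (Suc N) (Suc n) \<and> rk (hd p) \<noteq> Suc N.
      prod_list (map w (filter (\<lambda>x. rk x = Suc N) p)) * F (filter (\<lambda>x. rk x \<noteq> Suc N) p)) =
    (\<Sum>s\<le>n. of_nat (n choose s) * (\<Sum>a | rk a = Suc N. w a) ^ s *
      (\<Sum>q\<in>parking_words N (Suc (n - s)). F q))"
proof -
  have B: "{a. a \<in> alphabet (Suc N) \<and> rk a \<noteq> Suc N} = alphabet N"
    by (auto simp: alphabet_def)
  let ?G = "\<lambda>q. if parks N q then F q else 0"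
  have "(\<Sum>p | p \<in> parking_words (Suc N) (Suc n) \<and> rk (hd p) \<noteq> Suc N.
      prod_list (map w (filter (\<lambda>x. rk x = Suc N) p)) * F (filter (\<lambda>x. rk x \<noteq> Suc N) p)) =
    (\<Sum>b\<in>alphabet N. \<Sum>p | set p \<subseteq> alphabet (Suc N) \<and> length p = n.
      prod_list (map w (filter (\<lambda>x. rk x = Suc N) p)) *
      ?G (b # filter (\<lambda>x. rk x \<noteq> Suc N) p))"
    unfolding sum_parking_words_hd_as_lists[OF N n, where P = "\<lambda>r. r \<noteq> Suc N"] B
    by (intro sum.cong refl) (auto simp: alphabet_def)
  also have "\<dots> = (\<Sum>b\<in>alphabet N. \<Sum>s\<le>n. of_nat (n choose s) * (\<Sum>a | rk a = Suc N. w a) ^ s *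
      (\<Sum>q | set q \<subseteq> alphabet N \<and> length q = n - s. ?G (b # q)))"
    by (intro sum.cong refl sum_insert_top[OF N, of w "\<lambda>q. ?G (_ # q)"])
  also have "\<dots> = (\<Sum>s\<le>n. of_nat (n choose s) * (\<Sum>a | rk a = Suc N. w a) ^ s *
      (\<Sum>q | set q \<subseteq> alphabet N \<and> length q = Suc (n - s). ?G q))"
    by (subst sum.swap) (simp add: sum_distrib_left[symmetric] sum_lists_Suc)
  finally show ?thesis
    using N by (simp add: sum_parking_words_as_lists)
qed


section \<open>Closed forms\<close>

text \<open>Multiplying by \<open>N + 1\<close> keeps the formula uniform: \<open>(N + 1 - n) (N + 1)\<^bsup>n - 1\<^esup> k\<^sup>n\<close> would have a
  negative exponent for the empty word. The case \<open>n = N + 1\<close>, where both sides vanish, is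
  included because the count for \<open>N + 1\<close> ranks and length \<open>N + 1\<close> has it as its term \<open>s = 0\<close>.\<close>

lemma card_parking_words:
  assumes "N \<le> m" "n \<le> Suc N"
  shows "of_nat (Suc N) * of_nat (card (parking_words N n)) =
    (of_nat (Suc N) - of_nat n) * (of_nat (Suc N * k) :: 'a::{idom, ring_char_0}) ^ n"
  using assms
proof (induction N arbitrary: n)
  case 0
  have "alphabet 0 = {}"
    by (auto simp: alphabet_def)
  then have "parking_words 0 0 = {[]}"
    by (auto simp: parking_words_def parks_def)
  then have zero: "card (parking_words 0 0) = 1"
    by simp
  have "n = 0 \<or> n = 1"
    using 0 by linarith
  then show ?case
    by (elim disjE) (simp_all add: zero parking_words_empty)
next
  case (Suc N)
  show ?case
  proof (cases "n = Suc (Suc N)")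
    case True
    then show ?thesis by (simp add: parking_words_empty)
  next
    case False
    then have n: "n \<le> Suc N" using Suc.prems by simp
    let ?K = "of_nat k :: 'a" and ?N = "of_nat (Suc N) :: 'a" and ?n = "of_nat n :: 'a"
    define z where "z = ?K + of_nat (Suc N * k)"
    have "of_nat (card (parking_words (Suc N) n)) =
        (\<Sum>s\<le>n. of_nat (n choose s) * ?K ^ s * of_nat (card (parking_words N (n - s))))"
      using sum_parking_words_Suc[OF Suc.prems(1) n, of "\<lambda>_. 1 :: 'a" "\<lambda>_. 1"]
      by (simp add: card_level Suc.prems(1) map_replicate_const)
    then have "?N * of_nat (card (parking_words (Suc N) n)) =
        (\<Sum>s\<le>n. of_nat (n choose s) * ?K ^ s * (?N * of_nat (card (parking_words N (n - s)))))"
      by (simp add: sum_distrib_left mult_ac)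
    also have "\<dots> = (\<Sum>s\<le>n. of_nat (n choose s) * ?K ^ s *
        ((?N - ?n + of_nat s) * (of_nat (Suc N * k)) ^ (n - s)))"
    proof (intro sum.cong refl)
      fix s assume "s \<in> {..n}"
      then have "?N * of_nat (card (parking_words N (n - s))) =
          (?N - ?n + of_nat s) * (of_nat (Suc N * k)) ^ (n - s)"
        using Suc.IH[of "n - s"] Suc.prems n by (simp add: of_nat_diff algebra_simps)
      then show "of_nat (n choose s) * ?K ^ s * (?N * of_nat (card (parking_words N (n - s)))) =
          of_nat (n choose s) * ?K ^ s * ((?N - ?n + of_nat s) * (of_nat (Suc N * k)) ^ (n - s))"
        by simp
    qed
    also have "\<dots> = (?N - ?n) * (?K + of_nat (Suc N * k)) ^ n +
        ?n * ?K * (?K + of_nat (Suc N * k)) ^ (n - 1)"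
      by (rule sum_binomial_affine)
    finally have rec: "?N * of_nat (card (parking_words (Suc N) n)) =
        (?N - ?n) * z ^ n + ?n * ?K * z ^ (n - 1)"
      unfolding z_def .
    \<comment> \<open>The base \<open>z\<close> is \<open>(N + 2) k\<close>, so the factor \<open>N + 2\<close> of the claim turns the derivative term
      into a multiple of \<open>z\<^sup>n\<close>.\<close>
    have zK: "(?N + 1) * ?K = z"
      by (simp add: z_def algebra_simps)
    have "(?N + 1) * (?n * ?K * z ^ (n - 1)) = ?n * ((?N + 1) * ?K * z ^ (n - 1))"
      by (simp only: mult_ac)
    also have "\<dots> = ?n * z ^ n"
      unfolding zK by (cases n) simp_all
    finally have pow: "(?N + 1) * (?n * ?K * z ^ (n - 1)) = ?n * z ^ n" .
    have "?N * ((?N + 1) * of_nat (card (parking_words (Suc N) n))) =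
        (?N + 1) * (?N * of_nat (card (parking_words (Suc N) n)))"
      by (simp only: mult_ac)
    also have "\<dots> = (?N + 1) * ((?N - ?n) * z ^ n) + ?n * z ^ n"
      unfolding rec distrib_left pow ..
    also have "\<dots> = ?N * ((?N + 1 - ?n) * z ^ n)"
      by (simp add: algebra_simps)
    finally have "(?N + 1) * of_nat (card (parking_words (Suc N) n)) =
        (?N + 1 - ?n) * z ^ n"
      by (rule mult_left_cancel[THEN iffD1, rotated]) (simp del: of_nat_Suc)
    then show ?thesis
      by (simp add: z_def algebra_simps)
  qed
qed

text \<open>If the first letter has top rank, the other ranks are only counted, by \<open>card_parking_words\<close>;
  otherwise the top rank is only counted and the induction hypothesis applies to the rest. With
  \<open>R\<close> ranks and \<open>z = V + R k\<close>, the derivative terms of these two binomial sums, multiplied by \<open>R\<close>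
  and without their common factor \<open>V\<close>, are \<open>n V z\<^bsup>n - 1\<^esup>\<close> and \<open>R n k z\<^bsup>n - 1\<^esup>\<close>; they add up to \<open>n z\<^sup>n\<close>.\<close>

lemma sum_weight_of_hd_level:
  fixes y :: "'b \<Rightarrow> 'a::{idom, ring_char_0}"
  assumes V: "\<And>i. 0 < i \<Longrightarrow> i \<le> m \<Longrightarrow> (\<Sum>a | rk a = i. y a) = V"
    and "N \<le> m" "n \<le> N"
  shows "(\<Sum>p\<in>parking_words N (Suc n). prod_list (map y (filter (\<lambda>x. rk x = rk (hd p)) p))) =
    V * (of_nat N - of_nat n) * (V + of_nat (N * k)) ^ n"
  using assms(2,3)
proof (induction N arbitrary: n)
  case 0
  then show ?case by (simp add: parking_words_empty)
next
  case (Suc N)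
  let ?w = "\<lambda>p. prod_list (map y (filter (\<lambda>x. rk x = rk (hd p)) p))"
  show ?case
  proof (cases "n = Suc N")
    case True
    then show ?thesis by (simp add: parking_words_empty)
  next
    case False
    then have n: "n \<le> N" using Suc.prems by simp
    let ?K = "of_nat k :: 'a" and ?N = "of_nat (Suc N) :: 'a" and ?n = "of_nat n :: 'a"
    let ?top = "\<Sum>p | p \<in> parking_words (Suc N) (Suc n) \<and> rk (hd p) = Suc N. ?w p"
    let ?below = "\<Sum>p | p \<in> parking_words (Suc N) (Suc n) \<and> rk (hd p) \<noteq> Suc N. ?w p"
    have split: "(\<Sum>p\<in>parking_words (Suc N) (Suc n). ?w p) = ?top + ?below"
      by (rule sum_parking_words_split_hd[OF Suc.prems(1)])
    have card: "?N * of_nat (card (parking_words N (n - s))) =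
        (?N - ?n + of_nat s) * (?N * ?K) ^ (n - s)" if "s \<le> n" for s
      using card_parking_words[of N "n - s", where 'a = 'a] that n Suc.prems(1)
      by (simp add: of_nat_diff algebra_simps)
    have "?top = V * (\<Sum>s\<le>n. of_nat (n choose s) * V ^ s *
        of_nat (card (parking_words N (n - s))))"
      using sum_parking_words_hd_top[OF Suc.prems(1) n, of y "\<lambda>_. 1"] V[of "Suc N"] Suc.prems(1)
      by (auto cong: conj_cong)
    then have "?N * ?top = V * (\<Sum>s\<le>n. of_nat (n choose s) * V ^ s *
        (?N * of_nat (card (parking_words N (n - s)))))"
      by (simp add: sum_distrib_left mult_ac)
    also have "\<dots> = V * (\<Sum>s\<le>n. of_nat (n choose s) * V ^ s *
        ((?N - ?n + of_nat s) * (?N * ?K) ^ (n - s)))"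
      by (simp add: card cong: sum.cong_simp del: of_nat_Suc)
    also have "\<dots> = V * ((?N - ?n) * (V + ?N * ?K) ^ n + ?n * V * (V + ?N * ?K) ^ (n - 1))"
      by (simp only: sum_binomial_affine)
    finally have top: "?N * ?top = \<dots>" .
    have "?below = (\<Sum>p | p \<in> parking_words (Suc N) (Suc n) \<and> rk (hd p) \<noteq> Suc N.
        prod_list (map (\<lambda>_. 1) (filter (\<lambda>x. rk x = Suc N) p)) *
        ?w (filter (\<lambda>x. rk x \<noteq> Suc N) p))"
    proof (intro sum.cong refl)
      fix p assume "p \<in> {p. p \<in> parking_words (Suc N) (Suc n) \<and> rk (hd p) \<noteq> Suc N}"
      then have p: "p \<noteq> []" "rk (hd p) \<noteq> Suc N"
        by (auto simp: parking_words_def)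
      then show "?w p = prod_list (map (\<lambda>_. 1) (filter (\<lambda>x. rk x = Suc N) p)) *
          ?w (filter (\<lambda>x. rk x \<noteq> Suc N) p)"
        by (simp add: filter_hd_level_drop_level map_replicate_const del: filter_filter)
    qed
    also have "\<dots> = (\<Sum>s\<le>n. of_nat (n choose s) * ?K ^ s *
        (\<Sum>q\<in>parking_words N (Suc (n - s)). ?w q))"
      unfolding sum_parking_words_hd_below[OF Suc.prems(1) n, of "\<lambda>_. 1" ?w]
      using Suc.prems(1) by (simp add: card_level)
    also have "\<dots> = (\<Sum>s\<le>n. of_nat (n choose s) * ?K ^ s *
        (((?N - 1 - ?n) + of_nat s) * (V + of_nat (N * k)) ^ (n - s))) * V"
      unfolding sum_distrib_right
      using n Suc.prems
      by (intro sum.cong refl) (subst Suc.IH, auto simp: of_nat_diff algebra_simps)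
    also have "\<dots> = ((?N - 1 - ?n) * (?K + (V + of_nat (N * k))) ^ n +
        ?n * ?K * (?K + (V + of_nat (N * k))) ^ (n - 1)) * V"
      by (simp only: sum_binomial_affine)
    also have "?K + (V + of_nat (N * k)) = V + ?N * ?K"
      by (simp add: algebra_simps)
    finally have below: "?below = ((?N - 1 - ?n) * (V + ?N * ?K) ^ n +
        ?n * ?K * (V + ?N * ?K) ^ (n - 1)) * V" .
    define z where "z = V + ?N * ?K"
    have "?n * V * z ^ (n - 1) + ?N * (?n * ?K * z ^ (n - 1)) = ?n * (z * z ^ (n - 1))"
      by (simp only: z_def ring_distribs mult_ac)
    also have "\<dots> = ?n * z ^ n"
      by (cases n) simp_all
    finally have pow: "?n * V * z ^ (n - 1) + ?N * (?n * ?K * z ^ (n - 1)) = ?n * z ^ n" .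
    have "?N * (?top + ?below) = V * ((?N - ?n) * z ^ n + ?N * ((?N - 1 - ?n) * z ^ n) +
        (?n * V * z ^ (n - 1) + ?N * (?n * ?K * z ^ (n - 1))))"
      unfolding distrib_left[of ?N] top below z_def[symmetric]
      by (simp only: distrib_left distrib_right mult_ac add_ac)
    also have "\<dots> = ?N * (V * (?N - ?n) * z ^ n)"
      unfolding pow by (simp add: algebra_simps)
    finally have "?top + ?below = V * (?N - ?n) * z ^ n"
      by (rule mult_left_cancel[THEN iffD1, rotated]) (simp del: of_nat_Suc)
    then show ?thesis
      unfolding split z_def of_nat_mult .
  qed
qed

text \<open>The top rank is weighted by \<open>x\<close> and, independently, the rank of the first letter by \<open>y\<close>; the two
  weights multiply when the first letter has top rank. The last summand is kept in the form in which
  the binomial sum produces it, because factoring out the power \<open>M - 1\<close> requires \<open>M > 0\<close>.\<close>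

lemma sum_weight_of_hd_and_top_level:
  fixes x y :: "'b \<Rightarrow> 'a::{idom, ring_char_0}"
  assumes V: "\<And>i. 0 < i \<Longrightarrow> i \<le> m \<Longrightarrow> (\<Sum>a | rk a = i. y a) = V"
    and m: "m = Suc M"
  defines "U \<equiv> \<Sum>a | rk a = m. x a" and "S \<equiv> \<Sum>a | rk a = m. x a * y a"
  shows "of_nat m * (\<Sum>p\<in>parking_words m m.
      prod_list (map x (filter (\<lambda>a. rk a = m) p)) *
      prod_list (map y (filter (\<lambda>a. rk a = rk (hd p)) p))) =
    of_nat m * (of_nat M * U * V * (U + V + of_nat (M * k)) ^ (M - 1)) +
    S * ((S + of_nat (m * k)) ^ M + of_nat M * S * (S + of_nat (m * k)) ^ (M - 1))"
proof -
  let ?x = "\<lambda>p. prod_list (map x (filter (\<lambda>a. rk a = m) p))"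
  let ?y = "\<lambda>p. prod_list (map y (filter (\<lambda>a. rk a = rk (hd p)) p))"
  let ?top = "\<Sum>p | p \<in> parking_words m m \<and> rk (hd p) = m. ?x p * ?y p"
  let ?below = "\<Sum>p | p \<in> parking_words m m \<and> rk (hd p) \<noteq> m. ?x p * ?y p"
  have split: "(\<Sum>p\<in>parking_words m m. ?x p * ?y p) = ?top + ?below"
    by (rule sum_parking_words_split_hd[OF le_refl])
  have M: "Suc M \<le> m" "M \<le> M"
    by (simp_all add: m)
  have card: "of_nat (Suc M) * of_nat (card (parking_words M (M - s))) =
      (1 + of_nat s) * (of_nat (m * k) :: 'a) ^ (M - s)" if "s \<le> M" for s
    using card_parking_words[of M "M - s", where 'a = 'a] that m
    by (simp add: of_nat_diff)
  have "?top = (\<Sum>p | p \<in> parking_words m m \<and> rk (hd p) = m.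
      prod_list (map (\<lambda>a. x a * y a) (filter (\<lambda>a. rk a = m) p)))"
    by (intro sum.cong refl) (simp add: prod_list_map_mult)
  also have "\<dots> = S * (\<Sum>s\<le>M. of_nat (M choose s) * S ^ s * of_nat (card (parking_words M (M - s))))"
    using sum_parking_words_hd_top[OF M(1,2), of "\<lambda>a. x a * y a" "\<lambda>_. 1"]
    by (simp add: S_def m)
  finally have "of_nat m * ?top = S * (\<Sum>s\<le>M. of_nat (M choose s) * S ^ s *
      (of_nat (Suc M) * of_nat (card (parking_words M (M - s)))))"
    by (simp add: sum_distrib_left mult_ac m)
  also have "\<dots> = S * (\<Sum>s\<le>M. of_nat (M choose s) * S ^ s *
      ((1 + of_nat s) * of_nat (m * k) ^ (M - s)))"
    by (simp add: card cong: sum.cong_simp del: of_nat_Suc of_nat_mult)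
  finally have top: "of_nat m * ?top =
      S * ((S + of_nat (m * k)) ^ M + of_nat M * S * (S + of_nat (m * k)) ^ (M - 1))"
    by (simp only: sum_binomial_affine mult_1_left)
  have "?below = (\<Sum>p | p \<in> parking_words m m \<and> rk (hd p) \<noteq> m.
      ?x p * ?y (filter (\<lambda>a. rk a \<noteq> m) p))"
  proof (intro sum.cong refl)
    fix p assume "p \<in> {p. p \<in> parking_words m m \<and> rk (hd p) \<noteq> m}"
    then have p: "p \<noteq> []" "rk (hd p) \<noteq> m"
      by (auto simp: parking_words_def m)
    then show "?x p * ?y p = ?x p * ?y (filter (\<lambda>a. rk a \<noteq> m) p)"
      by (simp only: filter_hd_level_drop_level not_False_eq_True)
  qed
  also have "\<dots> = (\<Sum>s\<le>M. of_nat (M choose s) * U ^ s *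
      (\<Sum>q\<in>parking_words M (Suc (M - s)). ?y q))"
    using sum_parking_words_hd_below[OF M(1,2), of x ?y] by (simp add: U_def m)
  also have "\<dots> = (\<Sum>s\<le>M. of_nat (M choose s) * U ^ s *
      (of_nat s * (V + of_nat (M * k)) ^ (M - s))) * V"
    unfolding sum_distrib_right
    by (intro sum.cong refl)
      (subst sum_weight_of_hd_level[OF V], auto simp: m of_nat_diff algebra_simps)
  also have "\<dots> = of_nat M * U * V * (U + V + of_nat (M * k)) ^ (M - 1)"
    unfolding sum_binomial_weight by (simp add: mult_ac add_ac)
  finally show ?thesis
    unfolding split distrib_left top by simp
qed

end


section \<open>Parking functions as parking words\<close>

lemma prod_power_count_list:
  fixes y :: "'b \<Rightarrow> 'a::comm_monoid_mult"
  assumes "finite A"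
  shows "(\<Prod>a\<in>A. y a ^ count_list p a) = prod_list (map y (filter (\<lambda>a. a \<in> A) p))"
proof (induction p)
  case (Cons b p)
  have "(\<Prod>a\<in>A. y a ^ count_list (b # p) a) =
      (\<Prod>a\<in>A. if a = b then y a else 1) * (\<Prod>a\<in>A. y a ^ count_list p a)"
    unfolding prod.distrib[symmetric] by (intro prod.cong refl) simp
  then show ?case
    using assms by (simp add: Cons.IH)
qed simp

text \<open>The entries of a sorted list that exceed \<open>c\<close> form a suffix.\<close>

lemma sorted_nth_le_iff:
  fixes xs :: "'b::linorder list"
  assumes "sorted xs" "j < length xs"
  shows "xs ! j \<le> c \<longleftrightarrow> length (filter (\<lambda>x. c < x) xs) \<le> length xs - Suc j"
proof
  assume "xs ! j \<le> c"
  have "x \<le> c" if "x \<in> set (take (Suc j) xs)" for x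
  proof -
    from that obtain i where "i \<le> j" "x = xs ! i"
      using assms(2) by (auto simp: in_set_conv_nth less_Suc_eq_le)
    then show ?thesis
      using sorted_nth_mono[OF assms(1), of i j] assms(2) \<open>xs ! j \<le> c\<close> by simp
  qed
  then have "filter (\<lambda>x. c < x) (take (Suc j) xs) = []"
    by (auto simp: filter_empty_conv not_less)
  then have "filter (\<lambda>x. c < x) (take (Suc j) xs @ drop (Suc j) xs) =
      filter (\<lambda>x. c < x) (drop (Suc j) xs)"
    unfolding filter_append by simp
  then show "length (filter (\<lambda>x. c < x) xs) \<le> length xs - Suc j"
    by (metis append_take_drop_id length_drop length_filter_le)
next
  assume len: "length (filter (\<lambda>x. c < x) xs) \<le> length xs - Suc j"
  show "xs ! j \<le> c"
  proof (rule ccontr)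
    assume c: "\<not> xs ! j \<le> c"
    have "c < x" if "x \<in> set (drop j xs)" for x
    proof -
      from that obtain i where "i < length xs - j" "x = xs ! (j + i)"
        by (auto simp: in_set_conv_nth)
      moreover from this have "j + i < length xs"
        by linarith
      ultimately show ?thesis
        using sorted_nth_mono[OF assms(1), of j "j + i"] c by simp
    qed
    then have "filter (\<lambda>x. c < x) (drop j xs) = drop j xs"
      by (simp add: filter_id_conv)
    then have "length xs - j \<le> length (filter (\<lambda>x. c < x) (take j xs @ drop j xs))"
      unfolding filter_append by simp
    then show False
      using len assms(2) by simp
  qed
qed

lemma mem_PF_iff:
  "p \<in> PF k m \<longleftrightarrow> length p = m \<and> (\<forall>a\<in>set p. a > 0) \<and>
    (\<forall>i\<in>{1..m}. length (filter (\<lambda>a. i * k < a) p) \<le> m - i)"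
proof -
  have "sort p ! (i - 1) \<le> i * k \<longleftrightarrow> length (filter (\<lambda>a. i * k < a) p) \<le> m - i"
    if "length p = m" "i \<in> {1..m}" for i
  proof -
    have "i - 1 < length (sort p)" "Suc (i - 1) = i"
      using that by auto
    from sorted_nth_le_iff[OF sorted_sort this(1), of "i * k"] this(2) show ?thesis
      by (simp add: filter_sort that(1))
  qed
  then show ?thesis
    unfolding PF_def by blast
qed

text \<open>The blocks are numbered from the end, the first one having rank \<open>m\<close>. Rank \<open>0\<close> collects the
  numbers that no parking function contains: \<open>0\<close> by the explicit case, and those above \<open>m k\<close> by the
  truncated subtraction.\<close>

definition block_rank :: "nat \<Rightarrow> nat \<Rightarrow> nat \<Rightarrow> nat" where
  "block_rank k m a = (if a = 0 then 0 else m - (a - 1) div k)"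

lemma block_rank_level:
  assumes "k > 0" "0 < i" "i \<le> m"
  shows "{a. block_rank k m a = i} = {1 + (m - i) * k..k + (m - i) * k}"
proof -
  have "block_rank k m a = i \<longleftrightarrow> a \<in> {1 + (m - i) * k..k + (m - i) * k}" for a
  proof (cases a)
    case (Suc z)
    have "z div k = m - i \<longleftrightarrow> (m - i) * k \<le> z \<and> z < Suc (m - i) * k"
      using less_eq_div_iff_mult_less_eq[OF assms(1), of "m - i" z]
        div_less_iff_less_mult[OF assms(1), of z "Suc (m - i)"] by linarith
    moreover have "m - z div k = i \<longleftrightarrow> z div k = m - i"
      using assms(2,3) by linarith
    ultimately show ?thesis
      by (auto simp: Suc block_rank_def)
  qed (use assms in \<open>simp add: block_rank_def\<close>)
  then show ?thesis by blast
qed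

lemma ranked_alphabet_block_rank:
  assumes "k > 0"
  shows "ranked_alphabet (block_rank k m) k m"
  using assms by unfold_locales (simp_all add: block_rank_level)

text \<open>For \<open>i = m - j\<close>, having rank at most \<open>i\<close> means lying beyond the first \<open>j\<close> blocks. The condition at
  \<open>i = m\<close> is trivial for words of length \<open>m\<close>, and the one at \<open>i = 0\<close> confines the letters to
  \<open>{1..m * k}\<close>.\<close>

lemma PF_eq_parking_words:
  assumes "k > 0"
  shows "PF k m = ranked_alphabet.parking_words (block_rank k m) m m"
proof -
  interpret ranked_alphabet "block_rank k m" k m
    by (rule ranked_alphabet_block_rank[OF assms])
  have rank_le: "block_rank k m a \<le> m - i \<longleftrightarrow> i * k < a" if "a > 0" "i \<le> m" for a i
  proof (cases a)
    case (Suc z)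
    have "m - z div k \<le> m - i \<longleftrightarrow> i \<le> z div k"
      using that(2) by linarith
    then show ?thesis
      using less_eq_div_iff_mult_less_eq[OF assms, of i z]
      by (simp add: Suc block_rank_def less_Suc_eq_le)
  qed (use that in simp)
  have "p \<in> PF k m \<longleftrightarrow> p \<in> parking_words m m" for p
  proof (cases "length p = m \<and> (\<forall>a\<in>set p. a > 0)")
    case True
    then have len: "length p = m" and pos: "\<And>a. a \<in> set p \<Longrightarrow> a > 0"
      by auto
    have count: "length (filter (\<lambda>a. block_rank k m a \<le> m - i) p) =
        length (filter (\<lambda>a. i * k < a) p)" if "i \<le> m" for i
      using pos that by (intro arg_cong[of _ _ length] filter_cong) (auto simp: rank_le)
    have "parks m p \<longleftrightarrow> (\<forall>i\<le>m. length (filter (\<lambda>a. block_rank k m a \<le> m - i) p) \<le> m - i)"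
      unfolding parks_def by (metis diff_diff_cancel diff_le_self)
    also have "\<dots> \<longleftrightarrow> (\<forall>i\<le>m. length (filter (\<lambda>a. i * k < a) p) \<le> m - i)"
      by (simp add: count)
    also have "\<dots> \<longleftrightarrow> (\<forall>i\<in>{1..m}. length (filter (\<lambda>a. i * k < a) p) \<le> m - i)"
    proof -
      have "length (filter (\<lambda>a. 0 * k < a) p) \<le> m - 0"
        using len by (metis diff_zero length_filter_le)
      then show ?thesis
        by (metis One_nat_def Suc_leI atLeastAtMost_iff neq0_conv)
    qed
    also have "\<dots> \<longleftrightarrow> p \<in> PF k m"
      using True by (simp add: mem_PF_iff)
    finally have parks: "parks m p \<longleftrightarrow> p \<in> PF k m" .
    have "set p \<subseteq> alphabet m" if "parks m p"
    proof
      fix a assume a: "a \<in> set p"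
      have "filter (\<lambda>a. block_rank k m a \<le> 0) p = []"
        using that unfolding parks_def by (metis le0 le_zero_eq length_0_conv)
      then show "a \<in> alphabet m"
        using a by (auto simp: filter_empty_conv alphabet_def block_rank_def)
    qed
    then show ?thesis
      using parks len by (auto simp: parking_words_def)
  next
    case False
    have "a > 0" if "p \<in> parking_words m m" "a \<in> set p" for a
      using that by (auto simp: parking_words_def alphabet_def block_rank_def split: if_splits)
    moreover have "length p = m" if "p \<in> parking_words m m"
      using that by (simp add: parking_words_def)
    ultimately show ?thesis
      using False by (auto simp: mem_PF_iff)
  qed
  then show ?thesis by blast
qed

lemma mod_within_block:
  fixes r k c :: nat
  assumes "r \<in> {1..k}"
  shows "(r + c * k - 1) mod k + 1 = r"
proof (cases r)
  case (Suc z)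
  then show ?thesis using assms by simp
qed (use assms in simp)

text \<open>The position of a letter within its block does not depend on the block. Hence one weight
  function on all letters describes the exponents of the \<open>y\<^sub>r\<close>, whichever block leads.\<close>

lemma prod_power_count_leading_block:
  fixes y :: "nat \<Rightarrow> 'a::comm_monoid_mult"
  assumes "k > 0" "m > 0" "p \<in> PF k m"
  shows "(\<Prod>r=1..k. y r ^ count_list p (leading_block k p * k - k + r)) =
    prod_list (map (\<lambda>a. y ((a - 1) mod k + 1))
      (filter (\<lambda>a. block_rank k m a = block_rank k m (hd p)) p))"
proof -
  interpret ranked_alphabet "block_rank k m" k m
    by (rule ranked_alphabet_block_rank[OF assms(1)])
  define l where "l = leading_block k p"
  define i where "i = block_rank k m (hd p)"
  have "p \<noteq> []"
    using assms(2,3) by (auto simp: PF_def)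
  then have hd: "hd p = p ! 0" "hd p \<in> set p"
    by (simp_all add: hd_conv_nth)
  have i: "0 < i" "i \<le> m"
    using hd(2) assms(3) unfolding PF_eq_parking_words[OF assms(1)] i_def
    by (auto simp: parking_words_def alphabet_def)
  note l = leading_block_bounds[OF assms, folded l_def]
  have c: "(m - i) * k = l * k - k"
  proof -
    have "hd p \<in> {1 + (m - i) * k..k + (m - i) * k}"
      using block_rank_level[OF assms(1) i] i_def by blast
    moreover have "hd p \<in> {1 + (l - 1) * k..k + (l - 1) * k}"
      using l by (auto simp: hd diff_mult_distrib)
    moreover have "m - i = l - 1" if "a \<in> {1 + (m - i) * k..k + (m - i) * k}"
        "a \<in> {1 + (l - 1) * k..k + (l - 1) * k}" for a
    proof -
      have quot: "(a - 1) div k = q" if "a \<in> {1 + q * k..k + q * k}" for q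
      proof (rule div_nat_eqI)
        have "1 + q * k \<le> a" "a \<le> k + q * k"
          using that by simp_all
        then show "k * q \<le> a - 1" "a - 1 < k * Suc q"
          using assms(1) by (simp_all add: mult.commute[of q])
      qed
      show ?thesis
        using quot[OF that(1)] quot[OF that(2)] by simp
    qed
    ultimately have "m - i = l - 1" by blast
    then show ?thesis by (simp add: diff_mult_distrib)
  qed
  have "(\<Prod>r=1..k. y r ^ count_list p (l * k - k + r)) =
      (\<Prod>a\<in>{1 + (m - i) * k..k + (m - i) * k}. y ((a - 1) mod k + 1) ^ count_list p a)"
    unfolding c[symmetric] prod.shift_bounds_cl_nat_ivl
    by (intro prod.cong refl) (simp only: mod_within_block add.commute[of "(m - i) * k"])
  also have "\<dots> = prod_list (map (\<lambda>a. y ((a - 1) mod k + 1)) (filter (\<lambda>a. block_rank k m a = i) p))"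
    unfolding block_rank_level[OF assms(1) i, symmetric]
    using i by (subst prod_power_count_list) (simp_all add: finite_level)
  finally show ?thesis
    unfolding l_def i_def .
qed

section \<open>The identity for rational functions\<close>

lemma to_fract_of_nat: "to_fract (of_nat n) = of_nat n"
  by (simp add: to_fract_def of_nat_fract)

text \<open>For sequences of length 1 the factor \<open>(x\<^sub>1 y\<^sub>1 + \<dots> + x\<^sub>k y\<^sub>k + k) powi (-1)\<close> has to cancel. Its base is
  nonzero because the constant term \<open>k\<close> of the polynomial is.\<close>

lemma sum_X_Y_add_nat_nonzero:
  assumes "k > 0"
  shows "(\<Sum>i\<in>I. X i * Y i) + of_nat k \<noteq> 0"
proof -
  let ?P = "\<Sum>i\<in>I. mpoly_var (2 * i) * mpoly_var (2 * i + 1)"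
  have "(\<Sum>i\<in>I. X i * Y i) = to_fract ?P"
    by (induction I rule: infinite_finite_induct) (simp_all add: X_def Y_def)
  then have "(\<Sum>i\<in>I. X i * Y i) + of_nat k = to_fract (?P + of_nat k)"
    by (simp add: to_fract_of_nat)
  moreover have "Poly_Mapping.lookup (mpoly_var (2 * i) * mpoly_var (2 * i + 1)) 0 = 0" for i
  proof -
    have "Poly_Mapping.lookup (Poly_Mapping.single (2 * i) (1::nat) + Poly_Mapping.single (2 * i + 1) 1) (2 * i) \<noteq> 0"
      by (simp add: lookup_add lookup_single)
    then have "Poly_Mapping.single (2 * i) (1::nat) + Poly_Mapping.single (2 * i + 1) 1 \<noteq> 0"
      by (metis lookup_zero)
    then show ?thesis
      by (simp add: mpoly_var_def mult_single lookup_single_not_eq)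
  qed
  then have "Poly_Mapping.lookup (?P + of_nat k) 0 = int k"
    by (simp add: lookup_add lookup_sum lookup_of_nat)
  then have "?P + of_nat k \<noteq> 0"
    using assms by (metis lookup_zero of_nat_0_less_iff less_irrefl)
  ultimately show ?thesis
    by (simp only: to_fract_eq_0_iff not_False_eq_True)
qed

theorem proposition7p10:
  fixes k m :: nat
  assumes "k > 0" and "m > 0"
  shows "(\<Sum>p\<in>PF k m. (\<Prod>i=1..k. X i ^ count_list p i) *
            (\<Prod>r=1..k. Y r ^ count_list p (leading_block k p * k - k + r)))
       = of_int (int m - 1) * (\<Sum>i=1..k. X i) * (\<Sum>i=1..k. Y i) *
            ((\<Sum>i=1..k. X i) + (\<Sum>i=1..k. Y i) + of_int ((int m - 1) * int k)) powi (int m - 2)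
         + (\<Sum>i=1..k. X i * Y i) * ((\<Sum>i=1..k. X i * Y i) + of_nat k) *
            ((\<Sum>i=1..k. X i * Y i) + of_nat (m * k)) powi (int m - 2)"
    (is "?lhs = ?rhs")
proof -
  interpret ranked_alphabet "block_rank k m" k m
    by (rule ranked_alphabet_block_rank[OF assms(1)])
  obtain M where m: "m = Suc M"
    using assms(2) gr0_implies_Suc by blast
  let ?U = "\<Sum>i=1..k. X i" and ?V = "\<Sum>i=1..k. Y i" and ?S = "\<Sum>i=1..k. X i * Y i"
  let ?y = "\<lambda>a. Y ((a - 1) mod k + 1)"
  have top: "{a. block_rank k m a = m} = {1..k}"
    using block_rank_level[OF assms(1,2) le_refl] by simp
  have V: "(\<Sum>a | block_rank k m a = i. ?y a) = ?V" if "0 < i" "i \<le> m" for i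
    unfolding block_rank_level[OF assms(1) that] sum.shift_bounds_cl_nat_ivl
    by (intro sum.cong refl) (simp only: mod_within_block)
  have S: "(\<Sum>a | block_rank k m a = m. X a * ?y a) = ?S"
    unfolding top by (intro sum.cong refl) (use mod_within_block[of _ k 0] in simp)
  have "?lhs = (\<Sum>p\<in>parking_words m m.
      prod_list (map X (filter (\<lambda>a. block_rank k m a = m) p)) *
      prod_list (map ?y (filter (\<lambda>a. block_rank k m a = block_rank k m (hd p)) p)))"
    unfolding PF_eq_parking_words[OF assms(1), symmetric]
  proof (intro sum.cong refl arg_cong2[of _ _ _ _ "(*)"])
    fix p assume p: "p \<in> PF k m"
    show "(\<Prod>i=1..k. X i ^ count_list p i) =
        prod_list (map X (filter (\<lambda>a. block_rank k m a = m) p))"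
      unfolding top[symmetric] using assms(2) by (subst prod_power_count_list) (simp_all add: finite_level)
    show "(\<Prod>r=1..k. Y r ^ count_list p (leading_block k p * k - k + r)) =
        prod_list (map ?y (filter (\<lambda>a. block_rank k m a = block_rank k m (hd p)) p))"
      by (rule prod_power_count_leading_block[OF assms p])
  qed
  then have main: "of_nat m * ?lhs = of_nat m * (of_nat M * ?U * ?V * (?U + ?V + of_nat (M * k)) ^ (M - 1)) +
      ?S * ((?S + of_nat (m * k)) ^ M + of_nat M * ?S * (?S + of_nat (m * k)) ^ (M - 1))"
    using sum_weight_of_hd_and_top_level[of ?y ?V M X, OF V m] by (simp only: S) (simp only: top)
  have "of_nat m * ?lhs = of_nat m * ?rhs"
  proof (cases M)
    case 0
    have "?S + of_nat k \<noteq> 0"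
      by (rule sum_X_Y_add_nat_nonzero[OF assms(1)])
    then show ?thesis
      unfolding main by (simp add: m 0 power_int_minus)
  next
    case (Suc j)
    have pow: "z powi (int m - 2) = z ^ j" for z :: ratfun
      by (simp add: m Suc)
    define z where "z = ?S + of_nat (m * k)"
    have "z + of_nat M * ?S = of_nat m * (?S + of_nat k)"
      by (simp add: z_def m algebra_simps)
    moreover have "?S * (z ^ M + of_nat M * ?S * z ^ (M - 1)) = ?S * ((z + of_nat M * ?S) * z ^ j)"
      unfolding Suc by (simp only: power_Suc diff_Suc_1 distrib_right mult.assoc)
    ultimately have "?S * (z ^ M + of_nat M * ?S * z ^ (M - 1)) =
        of_nat m * (?S * (?S + of_nat k) * z ^ j)"
      by (simp only: mult_ac)
    moreover have "of_int (int m - 1) = (of_nat M :: ratfun)"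
        "of_int ((int m - 1) * int k) = (of_nat (M * k) :: ratfun)"
      by (simp_all add: m)
    moreover have "M - 1 = j"
      by (simp add: Suc)
    ultimately show ?thesis
      unfolding main pow z_def[symmetric] by (simp only: distrib_left)
  qed
  then show ?thesis
    using assms(2) by simp
qed

end
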